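(* Let $\mathbb{F}$ be a field with $\operatorname{char}(\mathbb{F})\ne 2$, let $n\ge 1$, and let $\mathfrak{d}_n$ be the Dieudonné Leibniz algebra over $\mathbb{F}$ with its basis $\{e_1,\dots,e_{2n+1},z\}$. Every derivation of $\mathfrak{d}_n$ is represented with respect to this basis by a $(2n+2)\times(2n+2)$ matrix of the form $$\begin{pmatrix} \alpha I_{n+1} & C & 0\\ 0 & \beta I_n & 0\\ \mu & \nu & \alpha+\beta\end{pmatrix},$$ where $\alpha,\beta\in\mathbb{F}$, $\mu=(\mu_1,\dots,\mu_{n+1})\in\mathbb{F}^{n+1}$ and $\nu=(\nu_1,\dots,\nu_n)\in\mathbb{F}^n$ are row vectors, and $C$ is the $(n+1)\times n$ matrix with entries, for some $\alpha_1,\dots,\alpha_n\in\mathbb{F}$, $$C_{ij}=\begin{cases}(-1)^{i+1}\alpha_{(i+j)/2} & \text{if } i+j \text{ is even},\\ 0 & \text{if } i+j\text{ is odd},\end{cases}\qquad 1\le i\le n+1,\ 1\le j\le n.$$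
   Context: The Dieudonné Leibniz algebra $\mathfrak{d}_n$ is the $(2n+2)$-dimensional algebra over $\mathbb{F}$ with basis $\{e_1,\dots,e_{2n+1},z\}$ and bilinear bracket whose nonzero values on basis elements are $[e_1,e_{n+2}]=z$; $[e_i,e_{n+i}]=[e_i,e_{n+i+1}]=z$ for $i=2,\dots,n$; $[e_{n+1},e_{2n+1}]=z$; and $[e_i,e_{i-n}]=z$, $[e_i,e_{i-n-1}]=-z$ for $i=n+2,\dots,2n+1$. A derivation of an algebra $L$ with bracket $[-,-]$ is a linear map $d\colon L\to L$ with $d([x,y])=[d(x),y]+[x,d(y)]$ for all $x,y\in L$. Matrices are taken with respect to the ordered basis $(e_1,\dots,e_{2n+1},z)$, the columns being the coordinates of the images of the basis vectors. $I_m$ is the $m\times m$ identity matrix. *)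

theory Defs
  imports "Jordan_Normal_Form.VS_Connect"
begin

text \<open>
  The algebra is modelled on column vectors of dimension \<open>2 * n + 2\<close>, with the ordered basis
  \<open>e\<^sub>1, \<dots>, e\<^sub>2\<^sub>n\<^sub>+\<^sub>1, z\<close> being the standard one. The basis vectors keep their
  1-based numbering, while vector and matrix entries of the library are counted from 0:
  \<open>e\<^sub>i\<close> sits at position \<open>i - 1\<close> and \<open>z\<close> at position \<open>2 * n + 1\<close>.
\<close>

definition dieudonne_e :: "nat \<Rightarrow> nat \<Rightarrow> 'a::field vec" where
  "dieudonne_e n i = unit_vec (2 * n + 2) (i - 1)"

definition dieudonne_z :: "nat \<Rightarrow> 'a::field vec" where
  "dieudonne_z n = unit_vec (2 * n + 2) (2 * n + 1)"

text \<open>The coefficient of \<open>z\<close> in \<open>[e\<^sub>i, e\<^sub>j]\<close>.\<close>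

definition dieudonne_coeff :: "nat \<Rightarrow> nat \<Rightarrow> nat \<Rightarrow> 'a::field" where
  "dieudonne_coeff n i j =
    (if i = 1 \<and> j = n + 2 then 1
     else if 2 \<le> i \<and> i \<le> n \<and> (j = n + i \<or> j = n + i + 1) then 1
     else if i = n + 1 \<and> j = 2 * n + 1 then 1
     else if n + 2 \<le> i \<and> i \<le> 2 * n + 1 \<and> j = i - n then 1
     else if n + 2 \<le> i \<and> i \<le> 2 * n + 1 \<and> j = i - n - 1 then - 1
     else 0)"

text \<open>The bilinear extension; brackets with \<open>z\<close> vanish, so the last coordinates do not occur.\<close>

definition dieudonne_bracket :: "nat \<Rightarrow> 'a::field vec \<Rightarrow> 'a vec \<Rightarrow> 'a vec" where
  "dieudonne_bracket n x y =
    (\<Sum>i = 1..2 * n + 1. \<Sum>j = 1..2 * n + 1. x $ (i - 1) * y $ (j - 1) * dieudonne_coeff n i j)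
      \<cdot>\<^sub>v dieudonne_z n"

lemma dieudonne_bracket_e_e:
  assumes "i \<in> {1..2 * n + 1}" and "j \<in> {1..2 * n + 1}"
  shows "dieudonne_bracket n (dieudonne_e n i) (dieudonne_e n j) =
    (dieudonne_coeff n i j :: 'a::field) \<cdot>\<^sub>v dieudonne_z n"
proof -
  have ij: "1 \<le> i" "i \<le> 2 * n + 1" "1 \<le> j" "j \<le> 2 * n + 1"
    using assms by auto
  have e: "(dieudonne_e n k :: 'a vec) $ (l - 1) = (if l = k then 1 else 0)"
    if "1 \<le> k" "k \<le> 2 * n + 1" "1 \<le> l" "l \<le> 2 * n + 1" for k l
    using that by (auto simp: dieudonne_e_def)
  have "(\<Sum>k = 1..2 * n + 1. \<Sum>l = 1..2 * n + 1.
          (dieudonne_e n i :: 'a vec) $ (k - 1) * dieudonne_e n j $ (l - 1) * dieudonne_coeff n k l)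
      = (\<Sum>k = 1..2 * n + 1. \<Sum>l = 1..2 * n + 1.
          if k = i then if l = j then dieudonne_coeff n k l else 0 else 0)"
    by (intro sum.cong refl) (simp add: e ij del: One_nat_def)
  also have "\<dots> = (\<Sum>k = 1..2 * n + 1. if k = i then dieudonne_coeff n k j else 0)"
    using assms by (intro sum.cong refl) (simp del: One_nat_def)
  also have "\<dots> = dieudonne_coeff n i j"
    using assms by (simp del: One_nat_def)
  finally show ?thesis
    by (simp add: dieudonne_bracket_def)
qed

lemma dieudonne_bracket_z:
  "dieudonne_bracket n (dieudonne_z n) y = (0\<^sub>v (2 * n + 2) :: 'a::field vec)"
  "dieudonne_bracket n y (dieudonne_z n) = (0\<^sub>v (2 * n + 2) :: 'a::field vec)"
proof -
  have z: "(dieudonne_z n :: 'a vec) $ (i - 1) = 0" if "i \<in> {1..2 * n + 1}" for i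
    using that by (auto simp: dieudonne_z_def)
  show "dieudonne_bracket n (dieudonne_z n) y = (0\<^sub>v (2 * n + 2) :: 'a vec)"
    "dieudonne_bracket n y (dieudonne_z n) = (0\<^sub>v (2 * n + 2) :: 'a vec)"
    unfolding dieudonne_bracket_def
    by (simp_all add: z del: One_nat_def) (auto simp: dieudonne_z_def)
qed

definition derivation :: "nat \<Rightarrow> ('a::field vec \<Rightarrow> 'a vec \<Rightarrow> 'a vec) \<Rightarrow> ('a vec \<Rightarrow> 'a vec) \<Rightarrow> bool" where
  "derivation m br d \<longleftrightarrow>
    linear_map class_ring (module_vec TYPE('a) m) (module_vec TYPE('a) m) d \<and>
    (\<forall>x \<in> carrier_vec m. \<forall>y \<in> carrier_vec m. d (br x y) = br (d x) y + br x (d y))"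

definition matrix_of :: "nat \<Rightarrow> ('a::field vec \<Rightarrow> 'a vec) \<Rightarrow> 'a mat" where
  "matrix_of m d = mat_of_cols m (map (\<lambda>j. d (unit_vec m j)) [0..<m])"

text \<open>The parameters \<open>a 1, \<dots>, a n\<close> are numbered from 1; the row and column indices are
  shifted to 1-based ones before the defining formula is applied.\<close>

definition C_block :: "nat \<Rightarrow> (nat \<Rightarrow> 'a::field) \<Rightarrow> 'a mat" where
  "C_block n a = mat (n + 1) n (\<lambda>(r, c). let i = r + 1; j = c + 1 in
    if even (i + j) then (- 1) ^ (i + 1) * a ((i + j) div 2) else 0)"

definition derivation_form ::
  "nat \<Rightarrow> 'a::field \<Rightarrow> 'a \<Rightarrow> (nat \<Rightarrow> 'a) \<Rightarrow> 'a vec \<Rightarrow> 'a vec \<Rightarrow> 'a mat" where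
  "derivation_form n \<alpha> \<beta> a \<mu> \<nu> =
    four_block_mat
      (four_block_mat (\<alpha> \<cdot>\<^sub>m 1\<^sub>m (n + 1)) (C_block n a) (0\<^sub>m n (n + 1)) (\<beta> \<cdot>\<^sub>m 1\<^sub>m n))
      (0\<^sub>m (2 * n + 1) 1)
      (mat_of_row (\<mu> @\<^sub>v \<nu>))
      (mat 1 1 (\<lambda>_. \<alpha> + \<beta>))"

end

theory Submission
  imports Defs
begin

text \<open>
  Write the bracket as \<open>[x, y] = f(x, y) z\<close>. Since \<open>z\<close> is itself a bracket, a derivation \<open>d\<close>
  satisfies \<open>d z = \<gamma> z\<close>, and since \<open>z\<close> is central, \<open>d\<close> is a derivation exactly when the matrix \<open>D\<close>
  that it induces on the span of \<open>e\<^sub>1, \<dots>, e\<^sub>2\<^sub>n\<^sub>+\<^sub>1\<close> is an infinitesimal similitude of \<open>f\<close>: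
  \<open>D\<^sup>T F + F D = \<gamma> F\<close>, where \<open>F\<close> is the matrix of \<open>f\<close>. The coefficients of \<open>z\<close> in \<open>d e\<^sub>i\<close> are
  unconstrained; they are \<open>\<mu>\<close> and \<open>\<nu>\<close>.

  Split the indices into the first \<open>n + 1\<close> and the last \<open>n\<close>. Then \<open>F\<close> has zero diagonal blocks
  and two off-diagonal blocks \<open>A\<close>, \<open>B\<close> with \<open>A i j = 1\<close> for \<open>i \<in> {j, j + 1}\<close>, and \<open>B j i = 1\<close> for
  \<open>i = j + 1\<close>, \<open>B j i = -1\<close> for \<open>i = j\<close>. With \<open>D\<close> consisting of the blocks \<open>P\<close>, \<open>Q\<close> (top) and
  \<open>R\<close>, \<open>S\<close> (bottom), the equation separates into one for \<open>R\<close>, one for \<open>Q\<close>, and two that link \<open>P\<close>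
  and \<open>S\<close>. As \<open>F\<close> is neither symmetric nor skew, each equation comes with its mirror image that
  differs in signs only; adding and subtracting the two, and dividing by 2, leaves shift
  relations between neighbouring entries:

  \<^item> \<open>R\<close> and \<open>Q\<close> are symmetric where this makes sense and change sign with every step along an
    antidiagonal. Continued by zero rows, \<open>R\<close> has all its antidiagonals running into zeros, so it
    vanishes (\<open>antidiagonal_zero\<close>). In \<open>Q\<close> each antidiagonal is governed by its middle: an even
    one by a free diagonal entry \<open>\<plusminus>\<alpha>\<^sub>m\<close>, an odd one by an entry that equals its own negative
    (\<open>antidiagonal_alternating\<close>). This is the block \<open>C\<close>.
  \<^item> Eliminating \<open>P\<close>, the block \<open>S\<close> is constant along diagonals; continued by zero rows, all
    diagonals but the main one run into zeros, so \<open>S = \<beta> I\<close> (\<open>toeplitz_scalar\<close>), and then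
    \<open>P = (\<gamma> - \<beta>) I\<close>.
\<close>

section \<open>Arrays constant up to sign along diagonals\<close>

lemma sum_diff_cancel:
  fixes a b p q :: "'a::idom"
  assumes "(2::'a) \<noteq> 0" and "p + q = a + b" and "p - q = a - b"
  shows "p = a" and "q = b"
proof -
  have "2 * p = (p + q) + (p - q)" by simp
  also have "\<dots> = 2 * a" by (simp only: assms(2,3)) simp
  finally show "p = a" using assms(1) by simp
  with assms(2) show "q = b" by simp
qed

text \<open>
  The recurrence and its transpose give symmetry and the sign rule \<open>R i (k + 1) = - R k (i + 1)\<close>.
  Together they move an entry along its antidiagonal towards larger row index and smaller
  column index, so it ends in row \<open>n + 1\<close>, or in column 1 and by the sign rule in row 0.
\<close>
lemma antidiagonal_zero:
  fixes R :: "nat \<Rightarrow> nat \<Rightarrow> 'a::idom"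
  assumes two: "(2::'a) \<noteq> 0"
    and bot: "\<And>k. R 0 k = 0" and top: "\<And>k. R (Suc n) k = 0"
    and eq: "\<And>i k. i \<le> n \<Longrightarrow> k \<le> n \<Longrightarrow>
      R k (Suc i) - R (Suc k) (Suc i) + (R i (Suc k) + R (Suc i) (Suc k)) = 0"
    and "i \<le> Suc n" and "1 \<le> k" and "k \<le> Suc n"
  shows "R i k = 0"
proof -
  \<comment> \<open>The recurrence at \<open>(i, k)\<close> and at \<open>(k, i)\<close> are a sum and a difference of the same two terms.\<close>
  have shift: "R i (Suc k) = - R k (Suc i)" and sym: "R (Suc i) (Suc k) = R (Suc k) (Suc i)"
    if "i \<le> n" "k \<le> n" for i k
    using sum_diff_cancel[OF two, of "R i (Suc k)" "R (Suc i) (Suc k)" "- R k (Suc i)" "R (Suc k) (Suc i)"]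
      eq[OF that] eq[OF that(2,1)] by (simp_all add: algebra_simps)
  have "R i (Suc k) = 0" if "k \<le> n" "i \<le> Suc n" for i k
    using that
  proof (induction k arbitrary: i)
    case 0
    then show ?case using shift[of i 0] bot top by (cases "i = Suc n") auto
  next
    case (Suc k)
    show ?case
    proof (cases "i = Suc n")
      case False
      with Suc.prems have "R i (Suc (Suc k)) = - R (Suc k) (Suc i)" by (intro shift) auto
      also have "\<dots> = - R (Suc i) (Suc k)" using sym[of i k] Suc.prems False by simp
      also have "\<dots> = 0" using Suc.IH[of "Suc i"] Suc.prems False by simp
      finally show ?thesis .
    qed (simp add: top)
  qed
  from this[of "k - 1" i] assms show ?thesis by simp
qed

text \<open>
  The symmetry \<open>Q k i = Q i k\<close> only concerns the square part with both indices in \<open>{1..n}\<close>; row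
  \<open>n + 1\<close> is reached by the sign rule. The right-hand side is the block \<open>C\<close> with
  \<open>\<alpha>\<^sub>m = (-1)\<^sup>m\<^sup>+\<^sup>1 Q m m\<close>.
\<close>
lemma antidiagonal_alternating:
  fixes Q :: "nat \<Rightarrow> nat \<Rightarrow> 'a::idom"
  assumes two: "(2::'a) \<noteq> 0"
    and eq: "\<And>i k. 1 \<le> i \<Longrightarrow> i \<le> n \<Longrightarrow> 1 \<le> k \<Longrightarrow> k \<le> n \<Longrightarrow>
      Q k i + Q (Suc k) i + (Q (Suc i) k - Q i k) = 0"
    and "1 \<le> i" and "i \<le> Suc n" and "1 \<le> k" and "k \<le> n"
  shows "Q i k = (if even (i + k)
    then (- 1) ^ (i + 1) * ((- 1) ^ ((i + k) div 2 + 1) * Q ((i + k) div 2) ((i + k) div 2)) else 0)"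
proof -
  have shift: "Q (Suc k) i = - Q (Suc i) k" and sym: "Q k i = Q i k"
    if "1 \<le> i" "i \<le> n" "1 \<le> k" "k \<le> n" for i k
    using sum_diff_cancel[OF two, of "Q (Suc k) i" "Q k i" "- Q (Suc i) k" "Q i k"]
      eq[OF that] eq[OF that(3,4,1,2)] by (simp_all add: algebra_simps)
  have step: "Q (Suc i) k = - Q i (Suc k)" if "1 \<le> i" "i \<le> n" "1 \<le> k" "k < n" for i k
    using shift[of i k] shift[of k i] sym[of "Suc k" i] that by simp
  have walk: "Q (i + t) k = (- 1) ^ t * Q i (k + t)"
    if "1 \<le> i" "i + t \<le> Suc n" "1 \<le> k" "k + t \<le> n" for i k t
    using that
  proof (induction t arbitrary: k)
    case (Suc t)
    then show ?case using step[of "i + t" k] Suc.IH[of "Suc k"] by simp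
  qed simp
  \<comment> \<open>The middle of an odd antidiagonal: the sign rule maps this entry to itself.\<close>
  have sub_diag: "Q (Suc m) m = 0" if "1 \<le> m" "m \<le> n" for m
  proof -
    have "2 * Q (Suc m) m = 0" using shift[of m m] that
      by (metis add.right_inverse mult_2)
    then show ?thesis using two by simp
  qed
  show ?thesis
  proof (cases "even (i + k)")
    case True
    then obtain m where m: "i + k = 2 * m" by (elim evenE)
    have "Q i k = (- 1) ^ (i + m) * Q m m"
    proof (cases "m \<le> i")
      case True
      define t where "t = i - m"
      have t: "i = m + t" "m = k + t" using True m by (auto simp: t_def)
      have "(- 1 :: 'a) ^ (i + m) = (- 1) ^ t" by (simp add: t(1) power_add flip: power_mult_distrib)
      with walk[of m t k] t assms show ?thesis by auto
    next
      case False
      define t where "t = m - i"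
      have t: "m = i + t" "k = m + t" using False m by (auto simp: t_def)
      have "(- 1 :: 'a) ^ (i + m) = (- 1) ^ t" by (simp add: t(1) power_add flip: power_mult_distrib)
      moreover have "Q m m = (- 1) ^ t * Q i k" using walk[of i t m] t assms by auto
      moreover have "(- 1 :: 'a) ^ t * (- 1) ^ t = 1" by (simp flip: power_mult_distrib)
      ultimately show ?thesis by (metis mult.assoc mult_1)
    qed
    with m show ?thesis by (simp add: power_add)
  next
    case False
    then obtain m where m: "i + k = 2 * m + 1" by (elim oddE)
    have "Q i k = 0"
    proof (cases "m < i")
      case True
      define t where "t = i - Suc m"
      have t: "i = Suc m + t" "m = k + t" using True m by (auto simp: t_def)
      with walk[of "Suc m" t k] sub_diag[of m] assms show ?thesis by auto
    next
      case False
      define t where "t = Suc m - i"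
      have t: "Suc m = i + t" "k = m + t" using False m by (auto simp: t_def)
      with walk[of i t m] sub_diag[of m] assms False show ?thesis by auto
    qed
    with False show ?thesis by simp
  qed
qed

text \<open>
  Following a diagonal upwards from above the main diagonal leads to row 0; following it
  downwards from below the main diagonal leads to row \<open>n + 1\<close>. The column index stays in
  \<open>{1..n}\<close> in both cases, so only zero rows are needed on the boundary.
\<close>
lemma toeplitz_scalar:
  fixes S :: "nat \<Rightarrow> nat \<Rightarrow> 'a::zero"
  assumes bot: "\<And>k. S 0 k = 0" and top: "\<And>k. S (Suc n) k = 0"
    and shift: "\<And>i k. i \<le> n \<Longrightarrow> 1 \<le> k \<Longrightarrow> k < n \<Longrightarrow> S (Suc i) (Suc k) = S i k"
    and "i \<le> Suc n" and "1 \<le> k" and "k \<le> n"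
  shows "S i k = (if i = k then S 1 1 else 0)"
proof -
  have walk: "S (i + t) (k + t) = S i k" if "i + t \<le> Suc n" "1 \<le> k" "k + t \<le> n" for i k t
    using that by (induction t) (simp_all add: shift)
  consider "i < k" | "i = k" | "k < i" by linarith
  then show ?thesis
  proof cases
    case 1
    then show ?thesis using walk[of 0 i "k - i"] bot assms by simp
  next
    case 2
    then show ?thesis using walk[of 1 "k - 1" 1] assms by simp
  next
    case 3
    then show ?thesis using walk[of i "Suc n - i" k] top assms by simp
  qed
qed

section \<open>Multiplying by the matrix of the bracket\<close>

text \<open>
  The last \<open>n\<close> of \<open>2 * n + 1\<close> coordinates, numbered from 1 and continued by zero. With this
  convention the products of a vector with the blocks of the bracket have the same two terms in
  all rows, the first and the last included.
\<close>
definition pad :: "nat \<Rightarrow> (nat \<Rightarrow> 'a::zero) \<Rightarrow> nat \<Rightarrow> 'a" where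
  "pad n x j = (if 1 \<le> j \<and> j \<le> n then x (n + 1 + j) else 0)"

lemma sum_coeff_left_low:
  fixes x :: "nat \<Rightarrow> 'a::field"
  assumes "n \<ge> 1" and "j \<le> n"
  shows "(\<Sum>k = 1..2 * n + 1. x k * dieudonne_coeff n k (Suc j)) = pad n x j - pad n x (Suc j)"
proof -
  have "(\<Sum>k = 1..2 * n + 1. x k * dieudonne_coeff n k (Suc j)) =
    (\<Sum>k = 1..2 * n + 1. (if k = n + 1 + j then pad n x j else 0)
      - (if k = n + 2 + j then pad n x (Suc j) else 0))"
    using assms by (intro sum.cong refl) (auto simp: dieudonne_coeff_def pad_def)
  also have "\<dots> = pad n x j - pad n x (Suc j)"
    unfolding sum_subtractf using assms by (auto simp: pad_def)
  finally show ?thesis .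
qed

lemma sum_coeff_right_low:
  fixes x :: "nat \<Rightarrow> 'a::field"
  assumes "n \<ge> 1" and "i \<le> n"
  shows "(\<Sum>k = 1..2 * n + 1. x k * dieudonne_coeff n (Suc i) k) = pad n x i + pad n x (Suc i)"
proof -
  have "(\<Sum>k = 1..2 * n + 1. x k * dieudonne_coeff n (Suc i) k) =
    (\<Sum>k = 1..2 * n + 1. (if k = n + 1 + i then pad n x i else 0)
      + (if k = n + 2 + i then pad n x (Suc i) else 0))"
    using assms by (intro sum.cong refl) (auto simp: dieudonne_coeff_def pad_def)
  also have "\<dots> = pad n x i + pad n x (Suc i)"
    unfolding sum.distrib using assms by (auto simp: pad_def)
  finally show ?thesis .
qed

lemma sum_coeff_left_high:
  fixes x :: "nat \<Rightarrow> 'a::field"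
  assumes "1 \<le> m" and "m \<le> n"
  shows "(\<Sum>k = 1..2 * n + 1. x k * dieudonne_coeff n k (n + 1 + m)) = x m + x (Suc m)"
proof -
  have "(\<Sum>k = 1..2 * n + 1. x k * dieudonne_coeff n k (n + 1 + m)) =
    (\<Sum>k = 1..2 * n + 1. (if k = m then x m else 0) + (if k = Suc m then x (Suc m) else 0))"
    using assms by (intro sum.cong refl) (auto simp: dieudonne_coeff_def)
  also have "\<dots> = x m + x (Suc m)"
    unfolding sum.distrib using assms by auto
  finally show ?thesis .
qed

lemma sum_coeff_right_high:
  fixes x :: "nat \<Rightarrow> 'a::field"
  assumes "1 \<le> m" and "m \<le> n"
  shows "(\<Sum>k = 1..2 * n + 1. x k * dieudonne_coeff n (n + 1 + m) k) = x (Suc m) - x m"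
proof -
  have "(\<Sum>k = 1..2 * n + 1. x k * dieudonne_coeff n (n + 1 + m) k) =
    (\<Sum>k = 1..2 * n + 1. (if k = Suc m then x (Suc m) else 0) - (if k = m then x m else 0))"
    using assms by (intro sum.cong refl) (auto simp: dieudonne_coeff_def)
  also have "\<dots> = x (Suc m) - x m"
    unfolding sum_subtractf using assms by auto
  finally show ?thesis .
qed

section \<open>Infinitesimal similitudes of the bracket form\<close>

text \<open>
  Here the matrix equation \<open>D\<^sup>T F + F D = \<gamma> F\<close> is solved: its four blocks are fed to the lemmas
  on diagonals and antidiagonals.
\<close>
lemma form_similitude_entries:
  fixes D :: "nat \<Rightarrow> nat \<Rightarrow> 'a::field"
  assumes two: "(2::'a) \<noteq> 0" and n: "n \<ge> 1"
    and rel: "\<forall>i\<in>{1..2 * n + 1}. \<forall>j\<in>{1..2 * n + 1}.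
      (\<Sum>k = 1..2 * n + 1. D k i * dieudonne_coeff n k j)
      + (\<Sum>k = 1..2 * n + 1. D k j * dieudonne_coeff n i k) = \<gamma> * dieudonne_coeff n i j"
  shows "\<exists>\<alpha> \<beta> a. \<alpha> + \<beta> = \<gamma>
    \<and> (\<forall>k\<in>{1..n + 1}. \<forall>i\<in>{1..n + 1}. D k i = (if k = i then \<alpha> else 0))
    \<and> (\<forall>k\<in>{1..n + 1}. \<forall>i\<in>{1..n}. D k (n + 1 + i) =
        (if even (k + i) then (- 1) ^ (k + 1) * a ((k + i) div 2) else 0))
    \<and> (\<forall>k\<in>{1..n}. \<forall>i\<in>{1..n + 1}. D (n + 1 + k) i = 0)
    \<and> (\<forall>k\<in>{1..n}. \<forall>i\<in>{1..n}. D (n + 1 + k) (n + 1 + i) = (if k = i then \<beta> else 0))"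
proof -
  define R where "R = (\<lambda>k i. pad n (\<lambda>l. D l i) k)"
  define S where "S = (\<lambda>k i. pad n (\<lambda>l. D l (n + 1 + i)) k)"
  define Q where "Q = (\<lambda>k i. D k (n + 1 + i))"
  have R: "R k i = 0" if "1 \<le> k" "k \<le> n" "1 \<le> i" "i \<le> n + 1" for k i
  proof (rule antidiagonal_zero[OF two, where R = R and n = n])
    fix i k assume ik: "i \<le> n" "k \<le> n"
    have "dieudonne_coeff n (Suc i) (Suc k) = (0::'a)"
      using ik n by (auto simp: dieudonne_coeff_def)
    with rel[rule_format, of "Suc i" "Suc k"] ik
    show "R k (Suc i) - R (Suc k) (Suc i) + (R i (Suc k) + R (Suc i) (Suc k)) = 0"
      by (simp only: sum_coeff_left_low[OF n] sum_coeff_right_low[OF n] R_def) simp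
  qed (use that in \<open>auto simp: R_def pad_def\<close>)
  have Q: "Q k i = (if even (k + i)
      then (- 1) ^ (k + 1) * ((- 1) ^ ((k + i) div 2 + 1) * Q ((k + i) div 2) ((k + i) div 2)) else 0)"
    if "1 \<le> k" "k \<le> n + 1" "1 \<le> i" "i \<le> n" for k i
  proof (rule antidiagonal_alternating[OF two, where Q = Q and n = n])
    fix i k assume ik: "1 \<le> i" "i \<le> n" "1 \<le> k" "k \<le> n"
    have "dieudonne_coeff n (n + 1 + i) (n + 1 + k) = (0::'a)"
      using ik by (auto simp: dieudonne_coeff_def)
    with rel[rule_format, of "n + 1 + i" "n + 1 + k"] ik
    show "Q k i + Q (Suc k) i + (Q (Suc i) k - Q i k) = 0"
      by (simp only: sum_coeff_left_high sum_coeff_right_high Q_def) simp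
  qed (use that in auto)
  \<comment> \<open>The equations at \<open>(e\<^sub>i\<^sub>+\<^sub>1, e\<^sub>n\<^sub>+\<^sub>1\<^sub>+\<^sub>k)\<close> and at the swapped pair have equal terms up to sign: their sum
    and difference separate what is attached to \<open>i = k\<close> from what is attached to \<open>i + 1 = k\<close>.\<close>
  have PS: "D (Suc k) (Suc i) + S i k = (if i = k then \<gamma> else 0)"
    "D k (Suc i) + S (Suc i) k = (if Suc i = k then \<gamma> else 0)"
    if ik: "i \<le> n" "1 \<le> k" "k \<le> n" for i k
  proof -
    have "dieudonne_coeff n (Suc i) (n + 1 + k) =
        (if i = k then 1 else 0) + (if Suc i = k then 1 else (0::'a))"
      using ik by (auto simp: dieudonne_coeff_def)
    with rel[rule_format, of "Suc i" "n + 1 + k"] ik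
    have 1: "D k (Suc i) + D (Suc k) (Suc i) + (S i k + S (Suc i) k)
      = (if i = k then \<gamma> else 0) + (if Suc i = k then \<gamma> else 0)"
      by (simp only: sum_coeff_left_high sum_coeff_right_low[OF n] S_def) (auto split: if_splits)
    have "dieudonne_coeff n (n + 1 + k) (Suc i) =
        (if i = k then 1 else 0) - (if Suc i = k then 1 else (0::'a))"
      using ik by (auto simp: dieudonne_coeff_def)
    with rel[rule_format, of "n + 1 + k" "Suc i"] ik
    have 2: "S i k - S (Suc i) k + (D (Suc k) (Suc i) - D k (Suc i))
      = (if i = k then \<gamma> else 0) - (if Suc i = k then \<gamma> else 0)"
      by (simp only: sum_coeff_left_low[OF n] sum_coeff_right_high S_def) (auto split: if_splits)
    let ?p = "D (Suc k) (Suc i) + S i k" and ?q = "D k (Suc i) + S (Suc i) k"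
    have "?p + ?q = (if i = k then \<gamma> else 0) + (if Suc i = k then \<gamma> else 0)"
      "?p - ?q = (if i = k then \<gamma> else 0) - (if Suc i = k then \<gamma> else 0)"
      unfolding 1[symmetric] 2[symmetric] by (simp_all add: algebra_simps)
    from sum_diff_cancel[OF two this]
    show "?p = (if i = k then \<gamma> else 0)" "?q = (if Suc i = k then \<gamma> else 0)" .
  qed
  have S: "S i k = (if i = k then S 1 1 else 0)" if "i \<le> Suc n" "1 \<le> k" "k \<le> n" for i k
  proof (rule toeplitz_scalar[where S = S and n = n])
    fix i k assume ik: "i \<le> n" "1 \<le> k" "k < n"
    \<comment> \<open>Both sides are determined by the same entry \<open>D (Suc k) (Suc i)\<close>.\<close>
    show "S (Suc i) (Suc k) = S i k"
      using PS(1)[of i k] PS(2)[of i "Suc k"] ik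
      by (metis Suc_eq_plus1 Suc_leI add_left_cancel le_add2 less_imp_le nat.inject)
  qed (use that in \<open>auto simp: S_def pad_def\<close>)
  have P: "D k i = (if k = i then \<gamma> - S 1 1 else 0)"
    if "1 \<le> k" "k \<le> n + 1" "1 \<le> i" "i \<le> n + 1" for k i
  \<comment> \<open>The second relation covers rows up to \<open>n\<close>; row \<open>n + 1\<close> needs the first one, at \<open>k = n\<close>.\<close>
  proof -
    obtain i' where i': "i = Suc i'" "i' \<le> n" using \<open>1 \<le> i\<close> \<open>i \<le> n + 1\<close> by (cases i) auto
    show ?thesis
    proof (cases "k = n + 1")
      case True
      then show ?thesis using PS(1)[of i' n] S[of i' n] i' n
        by (simp add: eq_diff_eq split: if_splits)
    next
      case False
      then show ?thesis using PS(2)[of i' k] S[of i k] i' that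
        by (simp add: eq_diff_eq split: if_splits)
    qed
  qed
  show ?thesis
  proof (intro exI conjI ballI)
    show "\<gamma> - S 1 1 + S 1 1 = \<gamma>" by simp
  next
    fix k i assume "k \<in> {1..n + 1}" "i \<in> {1..n + 1}"
    then show "D k i = (if k = i then \<gamma> - S 1 1 else 0)" by (intro P) auto
  next
    fix k i assume "k \<in> {1..n + 1}" "i \<in> {1..n}"
    then have "1 \<le> k" "k \<le> n + 1" "1 \<le> i" "i \<le> n" by auto
    from Q[OF this] show "D k (n + 1 + i) = (if even (k + i)
        then (- 1) ^ (k + 1) * (\<lambda>m. (- 1) ^ (m + 1) * Q m m) ((k + i) div 2) else 0)"
      by (simp only: Q_def)
  next
    fix k i assume "k \<in> {1..n}" "i \<in> {1..n + 1}"
    then show "D (n + 1 + k) i = 0" using R[of k i] by (simp add: R_def pad_def)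
  next
    fix k i assume "k \<in> {1..n}" "i \<in> {1..n}"
    then show "D (n + 1 + k) (n + 1 + i) = (if k = i then S 1 1 else 0)"
      using S[of k i] by (simp add: S_def pad_def split: if_splits)
  qed
qed

section \<open>Derivations in coordinates\<close>

lemma bracket_e_right:
  fixes x :: "'a::field vec"
  assumes "j \<in> {1..2 * n + 1}"
  shows "dieudonne_bracket n x (dieudonne_e n j) =
    (\<Sum>k = 1..2 * n + 1. x $ (k - 1) * dieudonne_coeff n k j) \<cdot>\<^sub>v dieudonne_z n"
proof -
  have "(\<Sum>l = 1..2 * n + 1. x $ (k - 1) * (dieudonne_e n j :: 'a vec) $ (l - 1) * dieudonne_coeff n k l)
    = (\<Sum>l = 1..2 * n + 1. if l = j then x $ (k - 1) * dieudonne_coeff n k j else 0)" for k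
    using assms by (intro sum.cong refl) (auto simp: dieudonne_e_def)
  with assms show ?thesis by (simp add: dieudonne_bracket_def del: One_nat_def)
qed

lemma bracket_e_left:
  fixes x :: "'a::field vec"
  assumes "i \<in> {1..2 * n + 1}"
  shows "dieudonne_bracket n (dieudonne_e n i) x =
    (\<Sum>k = 1..2 * n + 1. x $ (k - 1) * dieudonne_coeff n i k) \<cdot>\<^sub>v dieudonne_z n"
proof -
  have "(\<Sum>k = 1..2 * n + 1. \<Sum>l = 1..2 * n + 1.
        (dieudonne_e n i :: 'a vec) $ (k - 1) * x $ (l - 1) * dieudonne_coeff n k l)
    = (\<Sum>k = 1..2 * n + 1. if k = i then \<Sum>l = 1..2 * n + 1. x $ (l - 1) * dieudonne_coeff n i l else 0)"
    using assms by (intro sum.cong refl) (auto simp: dieudonne_e_def)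
  with assms show ?thesis by (simp add: dieudonne_bracket_def del: One_nat_def)
qed

text \<open>
  The scalar \<open>\<gamma>\<close> comes from \<open>z = [e\<^sub>1, e\<^sub>n\<^sub>+\<^sub>2]\<close>: the Leibniz rule writes \<open>d z\<close> as a sum of
  brackets, and all brackets are multiples of \<open>z\<close>. Comparing \<open>z\<close>-coordinates in the Leibniz rule
  for \<open>[e\<^sub>i, e\<^sub>j]\<close> then gives the matrix equation.
\<close>
lemma derivation_coordinates:
  fixes d :: "'a::field vec \<Rightarrow> 'a vec"
  assumes n: "n \<ge> 1" and d: "derivation (2 * n + 2) (dieudonne_bracket n) d"
  shows "\<exists>\<gamma>. d (dieudonne_z n) = \<gamma> \<cdot>\<^sub>v dieudonne_z n \<and>
    (\<forall>i\<in>{1..2 * n + 1}. \<forall>j\<in>{1..2 * n + 1}.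
      (\<Sum>k = 1..2 * n + 1. d (dieudonne_e n i) $ (k - 1) * dieudonne_coeff n k j)
      + (\<Sum>k = 1..2 * n + 1. d (dieudonne_e n j) $ (k - 1) * dieudonne_coeff n i k)
      = \<gamma> * dieudonne_coeff n i j)"
proof -
  let ?e = "dieudonne_e n :: nat \<Rightarrow> 'a vec" and ?z = "dieudonne_z n :: 'a vec"
  define L where "L = (\<lambda>i j.
      (\<Sum>k = 1..2 * n + 1. d (?e i) $ (k - 1) * dieudonne_coeff n k j)
      + (\<Sum>k = 1..2 * n + 1. d (?e j) $ (k - 1) * dieudonne_coeff n i k))"
  interpret d: linear_map class_ring "module_vec TYPE('a) (2 * n + 2)" "module_vec TYPE('a) (2 * n + 2)" d
    using d by (simp add: derivation_def)
  have smult: "d (c \<cdot>\<^sub>v x) = c \<cdot>\<^sub>v d x" if "x \<in> carrier_vec (2 * n + 2)" for c x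
    using d.f_smult[of c x] that by (simp add: module_vec_simps class_ring_simps)
  have e: "?e i \<in> carrier_vec (2 * n + 2)" for i by (simp add: dieudonne_e_def)
  have z: "?z \<in> carrier_vec (2 * n + 2)" by (simp add: dieudonne_z_def)
  have *: "dieudonne_coeff n i j \<cdot>\<^sub>v d ?z = L i j \<cdot>\<^sub>v ?z"
    if ij: "i \<in> {1..2 * n + 1}" "j \<in> {1..2 * n + 1}" for i j
  proof -
    have "dieudonne_coeff n i j \<cdot>\<^sub>v d ?z = d (dieudonne_bracket n (?e i) (?e j))"
      using ij z by (simp only: dieudonne_bracket_e_e smult)
    also have "\<dots> = dieudonne_bracket n (d (?e i)) (?e j) + dieudonne_bracket n (?e i) (d (?e j))"
      using d e by (auto simp: derivation_def)
    also have "\<dots> = L i j \<cdot>\<^sub>v ?z"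
      unfolding bracket_e_right[OF ij(2)] bracket_e_left[OF ij(1)] L_def
      by (simp only: add_smult_distrib_vec)
    finally show ?thesis .
  qed
  define \<gamma> where "\<gamma> = L 1 (n + 2)"
  have dz: "d ?z = \<gamma> \<cdot>\<^sub>v ?z"
    using *[of 1 "n + 2"] n by (simp add: dieudonne_coeff_def \<gamma>_def)
  show ?thesis
  proof (intro exI conjI ballI, rule dz)
    fix i j assume ij: "i \<in> {1..2 * n + 1}" "j \<in> {1..2 * n + 1}"
    have "(dieudonne_coeff n i j \<cdot>\<^sub>v d ?z) $ (2 * n + 1) = (L i j \<cdot>\<^sub>v ?z) $ (2 * n + 1)"
      by (simp only: *[OF ij])
    then have "L i j = \<gamma> * dieudonne_coeff n i j"
      unfolding dz by (simp add: dieudonne_z_def mult.commute)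
    then show "(\<Sum>k = 1..2 * n + 1. d (?e i) $ (k - 1) * dieudonne_coeff n k j)
      + (\<Sum>k = 1..2 * n + 1. d (?e j) $ (k - 1) * dieudonne_coeff n i k)
      = \<gamma> * dieudonne_coeff n i j"
      by (simp only: L_def)
  qed
qed

theorem theorem4p1:
  fixes n :: nat and d :: "'a::field vec \<Rightarrow> 'a vec"
  assumes "CHAR('a) \<noteq> 2" and "n \<ge> 1"
    and "derivation (2 * n + 2) (dieudonne_bracket n) d"
  shows "\<exists>(\<alpha>::'a) (\<beta>::'a) (a :: nat \<Rightarrow> 'a). \<exists>\<mu> \<in> carrier_vec (n + 1). \<exists>\<nu> \<in> carrier_vec n.
    matrix_of (2 * n + 2) d = derivation_form n \<alpha> \<beta> a \<mu> \<nu>"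
proof -
  have two: "(2::'a) \<noteq> 0"
  proof
    assume "(2::'a) = 0"
    then have "of_nat 2 = (0::'a)" by simp
    then have "CHAR('a) dvd 2" by (simp only: of_nat_eq_0_iff_char_dvd)
    then have "CHAR('a) = 1 \<or> CHAR('a) = 2" using prime_nat_iff two_is_prime_nat by blast
    with assms(1) show False by simp
  qed
  define D where "D k i = d (dieudonne_e n i) $ (k - 1)" for k i
  obtain \<gamma> where dz: "d (dieudonne_z n) = \<gamma> \<cdot>\<^sub>v dieudonne_z n"
    and rel: "\<forall>i\<in>{1..2 * n + 1}. \<forall>j\<in>{1..2 * n + 1}.
      (\<Sum>k = 1..2 * n + 1. D k i * dieudonne_coeff n k j)
      + (\<Sum>k = 1..2 * n + 1. D k j * dieudonne_coeff n i k) = \<gamma> * dieudonne_coeff n i j"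
    using derivation_coordinates[OF assms(2,3), folded D_def] by (elim exE conjE) (rule that)
  obtain \<alpha> \<beta> a where \<gamma>: "\<alpha> + \<beta> = \<gamma>"
    and P: "\<forall>k\<in>{1..n + 1}. \<forall>i\<in>{1..n + 1}. D k i = (if k = i then \<alpha> else 0)"
    and Q: "\<forall>k\<in>{1..n + 1}. \<forall>i\<in>{1..n}. D k (n + 1 + i) =
      (if even (k + i) then (- 1) ^ (k + 1) * a ((k + i) div 2) else 0)"
    and R: "\<forall>k\<in>{1..n}. \<forall>i\<in>{1..n + 1}. D (n + 1 + k) i = 0"
    and S: "\<forall>k\<in>{1..n}. \<forall>i\<in>{1..n}. D (n + 1 + k) (n + 1 + i) = (if k = i then \<beta> else 0)"
    using form_similitude_entries[OF two assms(2) rel] by (elim exE conjE) (rule that)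
  define \<mu> where "\<mu> = vec (n + 1) (\<lambda>i. D (2 * n + 2) (Suc i))"
  define \<nu> where "\<nu> = vec n (\<lambda>i. D (2 * n + 2) (n + 1 + Suc i))"
  \<comment> \<open>\<open>D\<close> has 1-based indices with \<open>z\<close> in row \<open>2 * n + 2\<close>; its column for \<open>z\<close> is given by \<open>d z\<close>.\<close>
  have entry: "matrix_of (2 * n + 2) d $$ (r, c) =
      (if c = 2 * n + 1 then if r = 2 * n + 1 then \<gamma> else 0 else D (Suc r) (Suc c))"
    if "r < 2 * n + 2" "c < 2 * n + 2" for r c
    using that dz by (auto simp: matrix_of_def mat_of_cols_def D_def dieudonne_e_def dieudonne_z_def
        simp del: upt_Suc)
  have form: "derivation_form n \<alpha> \<beta> a \<mu> \<nu> $$ (r, c) =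
      (if c = 2 * n + 1 then if r = 2 * n + 1 then \<gamma> else 0 else D (Suc r) (Suc c))"
    if rc: "r < 2 * n + 2" "c < 2 * n + 2" for r c
  proof -
    consider "c = 2 * n + 1" | "r = 2 * n + 1" "c < n + 1"
      | j where "r = 2 * n + 1" "c = n + 1 + j" "j < n"
      | "r < n + 1" "c < n + 1" | j where "r < n + 1" "c = n + 1 + j" "j < n"
      | i where "r = n + 1 + i" "i < n" "c < n + 1"
      | i j where "r = n + 1 + i" "i < n" "c = n + 1 + j" "j < n"
    proof -
      have split: "m < n + 1 \<or> (\<exists>i<n. m = n + 1 + i) \<or> m = 2 * n + 1" if "m < 2 * n + 2" for m
      proof (cases "m < n + 1 \<or> m = 2 * n + 1")
        case False
        with that show ?thesis by (intro disjI2 disjI1 exI[of _ "m - (n + 1)"]) auto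
      qed auto
      from split[OF rc(1)] split[OF rc(2)] show thesis using that by blast
    qed
    then show ?thesis
    proof cases
      case 1
      with rc show ?thesis by (simp add: derivation_form_def C_block_def \<gamma>)
    next
      case 2
      with rc show ?thesis
        by (simp add: derivation_form_def C_block_def \<mu>_def \<nu>_def mat_of_row_def)
    next
      case 3
      with rc show ?thesis
        by (simp add: derivation_form_def C_block_def \<mu>_def \<nu>_def mat_of_row_def)
    next
      case 4
      with rc P[rule_format, of "Suc r" "Suc c"] show ?thesis
        by (simp add: derivation_form_def C_block_def)
    next
      case 5
      with rc Q[rule_format, of "Suc r" "Suc j"] show ?thesis
        by (simp add: derivation_form_def C_block_def Let_def)
    next
      case 6
      with rc R[rule_format, of "Suc i" "Suc c"] show ?thesis
        by (simp add: derivation_form_def C_block_def)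
    next
      case 7
      with rc S[rule_format, of "Suc i" "Suc j"] show ?thesis
        by (simp add: derivation_form_def C_block_def)
    qed
  qed
  have "matrix_of (2 * n + 2) d = derivation_form n \<alpha> \<beta> a \<mu> \<nu>"
  proof (rule eq_matI)
    show "dim_row (matrix_of (2 * n + 2) d) = dim_row (derivation_form n \<alpha> \<beta> a \<mu> \<nu>)"
      "dim_col (matrix_of (2 * n + 2) d) = dim_col (derivation_form n \<alpha> \<beta> a \<mu> \<nu>)"
      by (simp_all add: matrix_of_def derivation_form_def C_block_def)
    fix r c
    assume "r < dim_row (derivation_form n \<alpha> \<beta> a \<mu> \<nu>)"
      "c < dim_col (derivation_form n \<alpha> \<beta> a \<mu> \<nu>)"
    then have "r < 2 * n + 2" "c < 2 * n + 2" by (simp_all add: derivation_form_def C_block_def)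
    then show "matrix_of (2 * n + 2) d $$ (r, c) = derivation_form n \<alpha> \<beta> a \<mu> \<nu> $$ (r, c)"
      by (simp only: entry form)
  qed
  moreover have "\<mu> \<in> carrier_vec (n + 1)" "\<nu> \<in> carrier_vec n" by (simp_all add: \<mu>_def \<nu>_def)
  ultimately show ?thesis by blast
qed

end
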